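(* Let $m$ be a positive integer such that $m=a^2+b^2+c^2$ for some integers $a,b,c$. If $m\notin\{1,2,3,14\}$, then there are integers $x,y,z$ such that $x^2+y^2+z^2=9m$, $xyz\not\equiv 0\pmod 3$, and $(x^2-1)(y^2-1)(z^2-1)\neq 0$. *)

theory Defs
  imports Complex_Main "HOL-Number_Theory.Cong"
begin

end

theory Submission
  imports Defs
begin

text \<open>
  Put \<open>(x, y, z) = (2(b + c) - a, 2(a + c) - b, 2(a + b) - c)\<close>, which is 3 times a reflection of
  \<open>(a, b, c)\<close>. So \<open>x\<^sup>2 + y\<^sup>2 + z\<^sup>2 = 9(a\<^sup>2 + b\<^sup>2 + c\<^sup>2)\<close>, and \<open>x, y, z\<close> are all congruent to
  \<open>2(a + b + c)\<close> modulo 3. It follows by descent that \<open>m\<close> has a representation \<open>(a, b, c)\<close> whose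
  entries are not all divisible by 3, and every choice of signs with \<open>3 \<nmid> \<plusminus>a \<plusminus> b \<plusminus> c\<close> then gives
  a representation of \<open>9m\<close> with entries prime to 3. If all of these contain an entry \<open>\<plusminus>1\<close>, then
  \<open>(a, b, c)\<close> satisfies a system of linear equations.

  If no or two entries of \<open>(a, b, c)\<close> are divisible by 3, at least three of the four sign classes
  are usable, and the resulting equations leave only \<open>m \<in> {1, 3, 19}\<close>. If exactly one entry is
  divisible by 3, only two classes are usable, but for the other two the unscaled reflection is
  integral and yields a second representation of \<open>m\<close>. Its two usable classes supply the
  missing equations, which leave \<open>m \<in> {2, 14, 155}\<close>. The values 19 and 155 are settled directly.
\<close>

section \<open>Reflections and residues modulo 3\<close>

definition reflects_to_unit :: "int \<Rightarrow> int \<Rightarrow> int \<Rightarrow> bool" where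
  "reflects_to_unit a b c \<longleftrightarrow>
     \<bar>2 * b + 2 * c - a\<bar> = 1 \<or> \<bar>2 * a + 2 * c - b\<bar> = 1 \<or> \<bar>2 * a + 2 * b - c\<bar> = 1"

definition all_reflect_to_unit :: "int \<Rightarrow> bool" where
  "all_reflect_to_unit m \<longleftrightarrow>
     (\<forall>a b c. m = a\<^sup>2 + b\<^sup>2 + c\<^sup>2 \<longrightarrow> \<not> 3 dvd a + b + c \<longrightarrow> reflects_to_unit a b c)"

lemma sum_squares_reflection:
  fixes a b c :: int
  shows "(2 * b + 2 * c - a)\<^sup>2 + (2 * a + 2 * c - b)\<^sup>2 + (2 * a + 2 * b - c)\<^sup>2
           = 9 * (a\<^sup>2 + b\<^sup>2 + c\<^sup>2)"
  by (simp add: power2_eq_square algebra_simps)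

lemma not_3_dvd_reflection:
  fixes a b c :: int
  assumes "\<not> 3 dvd a + b + c"
  shows "\<not> 3 dvd 2 * b + 2 * c - a" "\<not> 3 dvd 2 * a + 2 * c - b" "\<not> 3 dvd 2 * a + 2 * b - c"
  using assms by presburger+

lemma exists_sign_change:
  fixes a b :: int
  assumes "\<not> 3 dvd a" "\<not> 3 dvd b"
  obtains b' where "b'\<^sup>2 = b\<^sup>2" "3 dvd a - b'"
proof (cases "3 dvd a - b")
  case True
  then show ?thesis using that by blast
next
  case False
  then have "3 dvd a - (- b)" using assms by presburger
  then show ?thesis using that[of "- b"] by simp
qed

text \<open>Differences of the four signed sums are 2a, 2b and 2c, so 3 cannot divide all
  four.\<close>

lemma exists_signs_sum_not_3_dvd:
  fixes a b c :: int
  assumes "\<not> (3 dvd a \<and> 3 dvd b \<and> 3 dvd c)"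
  obtains a' b' c' where "a'\<^sup>2 = a\<^sup>2" "b'\<^sup>2 = b\<^sup>2" "c'\<^sup>2 = c\<^sup>2" "\<not> 3 dvd a' + b' + c'"
proof -
  have "\<not> 3 dvd a + b + c \<or> \<not> 3 dvd (- a) + b + c \<or> \<not> 3 dvd a + (- b) + c \<or> \<not> 3 dvd a + b + (- c)"
    using assms by presburger
  then show ?thesis
    using that[of a b c] that[of "- a" b c] that[of a "- b" c] that[of a b "- c"] by auto
qed

text \<open>Descent: divide out a common factor 3, use the representation found for the smaller
  number, and multiply back by 9 with a reflection, which keeps the entries prime to 3.\<close>

lemma exists_rep_not_all_3_dvd:
  fixes a b c :: int
  assumes "0 < a\<^sup>2 + b\<^sup>2 + c\<^sup>2"
  shows "\<exists>x y z. a\<^sup>2 + b\<^sup>2 + c\<^sup>2 = x\<^sup>2 + y\<^sup>2 + z\<^sup>2 \<and> \<not> (3 dvd x \<and> 3 dvd y \<and> 3 dvd z)"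
  using assms
proof (induction "nat (a\<^sup>2 + b\<^sup>2 + c\<^sup>2)" arbitrary: a b c rule: less_induct)
  case less
  show ?case
  proof (cases "3 dvd a \<and> 3 dvd b \<and> 3 dvd c")
    case False
    then show ?thesis by blast
  next
    case True
    then obtain p q r where abc: "a = 3 * p" "b = 3 * q" "c = 3 * r"
      by (auto elim!: dvdE)
    then have nine: "a\<^sup>2 + b\<^sup>2 + c\<^sup>2 = 9 * (p\<^sup>2 + q\<^sup>2 + r\<^sup>2)"
      by (simp add: power_mult_distrib)
    with less.prems have "0 < p\<^sup>2 + q\<^sup>2 + r\<^sup>2" "nat (p\<^sup>2 + q\<^sup>2 + r\<^sup>2) < nat (a\<^sup>2 + b\<^sup>2 + c\<^sup>2)"
      by (simp_all add: nat_less_eq_zless)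
    from less.hyps[OF this(2,1)] obtain x y z where
      xyz: "p\<^sup>2 + q\<^sup>2 + r\<^sup>2 = x\<^sup>2 + y\<^sup>2 + z\<^sup>2" "\<not> (3 dvd x \<and> 3 dvd y \<and> 3 dvd z)"
      by blast
    obtain x' y' z' where s: "x'\<^sup>2 = x\<^sup>2" "y'\<^sup>2 = y\<^sup>2" "z'\<^sup>2 = z\<^sup>2" "\<not> 3 dvd x' + y' + z'"
      using exists_signs_sum_not_3_dvd[OF xyz(2)] .
    have "a\<^sup>2 + b\<^sup>2 + c\<^sup>2
        = (2 * y' + 2 * z' - x')\<^sup>2 + (2 * x' + 2 * z' - y')\<^sup>2 + (2 * x' + 2 * y' - z')\<^sup>2"
      unfolding sum_squares_reflection s nine xyz(1) ..
    with not_3_dvd_reflection[OF s(4)] show ?thesis by blast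
  qed
qed

section \<open>Bounds from linear inequalities, then finite enumeration\<close>

text \<open>Weakening \<open>= 1\<close> to \<open>\<le> 1\<close> saves the case split on the sign and does not enlarge the coordinate
  bounds derived from it below.\<close>
lemma reflects_to_unitE:
  assumes "reflects_to_unit a b c"
  obtains "-1 \<le> 2 * b + 2 * c - a" "2 * b + 2 * c - a \<le> 1"
    | "-1 \<le> 2 * a + 2 * c - b" "2 * a + 2 * c - b \<le> 1"
    | "-1 \<le> 2 * a + 2 * b - c" "2 * a + 2 * b - c \<le> 1"
  using assms unfolding reflects_to_unit_def by linarith

text \<open>One alternative from each hypothesis confines (a, b, c) between three pairs of parallel
  planes; each of the 27 choices bounds all coordinates.\<close>

lemma three_sign_classes_bounds:
  assumes "reflects_to_unit (- a) b c" "reflects_to_unit a (- b) c" "reflects_to_unit a b (- c)"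
  shows "(-3 \<le> a \<and> a \<le> 3) \<and> (-3 \<le> b \<and> b \<le> 3) \<and> (-3 \<le> c \<and> c \<le> 3)"
  using assms by - (intro conjI; elim reflects_to_unitE; smt (verit))

lemma three_sign_classes_values:
  assumes "reflects_to_unit (- a) b c" "reflects_to_unit a (- b) c" "reflects_to_unit a b (- c)"
  shows "a\<^sup>2 + b\<^sup>2 + c\<^sup>2 \<in> {1, 3, 19}"
proof -
  have "a \<in> {-3, -2, -1, 0, 1, 2, 3}"
    "b \<in> {-3, -2, -1, 0, 1, 2, 3}"
    "c \<in> {-3, -2, -1, 0, 1, 2, 3}"
    using three_sign_classes_bounds[OF assms] by auto
  with assms show ?thesis
    by (elim insertE emptyE; simp add: reflects_to_unit_def)
qed

text \<open>With \<open>a = 3k\<close> and \<open>c = b - 3l\<close>, the triple \<open>(k - 2l, b - 2k - 2l, -(b - l + 2k))\<close> is the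
  unscaled reflection of \<open>(a, b, -c)\<close>, obtained by subtracting \<open>2(a + b - c)/3 = 2(k + l)\<close> from each
  entry.\<close>
lemma neighbour_first_bounds:
  assumes "reflects_to_unit (3 * k) b (b - 3 * l)" "reflects_to_unit (- 3 * k) b (b - 3 * l)"
    "reflects_to_unit (k - 2 * l) (b - 2 * k - 2 * l) (b - l + 2 * k)"
    "reflects_to_unit (2 * l - k) (b - 2 * k - 2 * l) (b - l + 2 * k)"
  shows "(-1 \<le> k \<and> k \<le> 1) \<and> (-1 \<le> l \<and> l \<le> 1) \<and> (-4 \<le> b \<and> b \<le> 4)"
  using assms by - (intro conjI; elim reflects_to_unitE; smt (verit))

lemma neighbour_first_values:
  assumes "reflects_to_unit (3 * k) b (b - 3 * l)" "reflects_to_unit (- 3 * k) b (b - 3 * l)"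
    "reflects_to_unit (k - 2 * l) (b - 2 * k - 2 * l) (b - l + 2 * k)"
    "reflects_to_unit (2 * l - k) (b - 2 * k - 2 * l) (b - l + 2 * k)"
  shows "(3 * k)\<^sup>2 + b\<^sup>2 + (b - 3 * l)\<^sup>2 \<in> {2, 14, 155}"
proof -
  have "k \<in> {-1, 0, 1}"
    "l \<in> {-1, 0, 1}"
    "b \<in> {-4, -3, -2, -1, 0, 1, 2, 3, 4}"
    using neighbour_first_bounds[OF assms] by auto
  with assms show ?thesis
    by (elim insertE emptyE; simp add: reflects_to_unit_def)
qed

text \<open>For the case that 3 divides the second entry of the reflected triple, whose sign is then
  free; before, it was the first entry.\<close>

lemma neighbour_second_bounds:
  assumes "reflects_to_unit (3 * k) b (b - 3 * l)" "reflects_to_unit (- 3 * k) b (b - 3 * l)"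
    "reflects_to_unit (k - 2 * l) (b - 2 * k - 2 * l) (b - l + 2 * k)"
    "reflects_to_unit (k - 2 * l) (2 * k + 2 * l - b) (b - l + 2 * k)"
  shows "(-3 \<le> k \<and> k \<le> 3) \<and> (-4 \<le> l \<and> l \<le> 4) \<and> (-5 \<le> b \<and> b \<le> 5)"
  using assms by - (intro conjI; elim reflects_to_unitE; smt (verit))

lemma neighbour_second_values:
  assumes "reflects_to_unit (3 * k) b (b - 3 * l)" "reflects_to_unit (- 3 * k) b (b - 3 * l)"
    "reflects_to_unit (k - 2 * l) (b - 2 * k - 2 * l) (b - l + 2 * k)"
    "reflects_to_unit (k - 2 * l) (2 * k + 2 * l - b) (b - l + 2 * k)"
  shows "(3 * k)\<^sup>2 + b\<^sup>2 + (b - 3 * l)\<^sup>2 \<in> {2, 14, 155}"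
proof -
  have "k \<in> {-3, -2, -1, 0, 1, 2, 3}"
    "l \<in> {-4, -3, -2, -1, 0, 1, 2, 3, 4}"
    "b \<in> {-5, -4, -3, -2, -1, 0, 1, 2, 3, 4, 5}"
    using neighbour_second_bounds[OF assms] by (auto, presburger)
  with assms show ?thesis
    by (elim insertE emptyE; simp add: reflects_to_unit_def)
qed

section \<open>Case analysis by the entries divisible by 3\<close>

lemma all_reflect_to_unitD:
  assumes "all_reflect_to_unit m" "m = a\<^sup>2 + b\<^sup>2 + c\<^sup>2" "\<not> 3 dvd a + b + c"
  shows "reflects_to_unit a b c"
  using assms unfolding all_reflect_to_unit_def by blast

lemma reflects_to_unit_swap: "reflects_to_unit a b c \<longleftrightarrow> reflects_to_unit a c b"
  unfolding reflects_to_unit_def by (auto simp: add.commute)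

lemma reflects_to_unit_minus:
  "reflects_to_unit (- a) (- b) (- c) \<longleftrightarrow> reflects_to_unit a b c"
  unfolding reflects_to_unit_def by linarith

lemma three_sign_classes_case:
  assumes "all_reflect_to_unit m" "m = a\<^sup>2 + b\<^sup>2 + c\<^sup>2"
    and "\<not> 3 dvd - a + b + c" "\<not> 3 dvd a + - b + c" "\<not> 3 dvd a + b + - c"
  shows "m \<in> {1, 3, 19}"
  unfolding assms(2)
  by (rule three_sign_classes_values; rule all_reflect_to_unitD[OF assms(1)]) (use assms in auto)

lemma one_3_dvd_case:
  assumes all: "all_reflect_to_unit m" and m: "m = a\<^sup>2 + b\<^sup>2 + c\<^sup>2"
    and "3 dvd a" "\<not> 3 dvd b" "\<not> 3 dvd c"
  shows "m \<in> {2, 14, 155}"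
proof -
  obtain k where a: "a = 3 * k" using \<open>3 dvd a\<close> by blast
  obtain c' where c': "c'\<^sup>2 = c\<^sup>2" "3 dvd b - c'"
    using exists_sign_change[OF \<open>\<not> 3 dvd b\<close> \<open>\<not> 3 dvd c\<close>] .
  then obtain l where "b - c' = 3 * l" by blast
  then have "c' = b - 3 * l" by simp
  with m a c'(1) have m1: "m = (3 * k)\<^sup>2 + b\<^sup>2 + (b - 3 * l)\<^sup>2" by simp
  have m2: "m = (k - 2 * l)\<^sup>2 + (b - 2 * k - 2 * l)\<^sup>2 + (b - l + 2 * k)\<^sup>2"
    unfolding m1 by (simp add: power2_eq_square algebra_simps)
  have r1: "reflects_to_unit (3 * k) b (b - 3 * l)"
    by (rule all_reflect_to_unitD[OF all m1]) (use \<open>\<not> 3 dvd b\<close> in presburger)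
  have r2: "reflects_to_unit (- 3 * k) b (b - 3 * l)"
    by (rule all_reflect_to_unitD[OF all]) (use m1 \<open>\<not> 3 dvd b\<close> in \<open>simp, presburger\<close>)
  \<comment> \<open>Modulo 3 these are the entries of the representation \<open>m2\<close>. As k + l
    is congruent to 0, -b or b, exactly one entry is divisible by 3.\<close>
  have "3 dvd k + l \<or> 3 dvd b + k + l \<or> 3 dvd b - k - l"
    using \<open>\<not> 3 dvd b\<close> by presburger
  then consider "3 dvd k + l" | "3 dvd b + k + l" | "3 dvd b - k - l" by blast
  then show ?thesis
  proof cases
    case 1
    have "reflects_to_unit (k - 2 * l) (b - 2 * k - 2 * l) (b - l + 2 * k)"
      by (rule all_reflect_to_unitD[OF all m2]) (use 1 \<open>\<not> 3 dvd b\<close> in presburger)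
    moreover have "reflects_to_unit (2 * l - k) (b - 2 * k - 2 * l) (b - l + 2 * k)"
      by (rule all_reflect_to_unitD[OF all])
        (simp add: m2 power2_eq_square algebra_simps, use 1 \<open>\<not> 3 dvd b\<close> in presburger)
    ultimately show ?thesis unfolding m1 by (rule neighbour_first_values[OF r1 r2])
  next
    case 2
    have "reflects_to_unit (k - 2 * l) (b - 2 * k - 2 * l) (b - l + 2 * k)"
      by (rule all_reflect_to_unitD[OF all m2]) (use 2 \<open>\<not> 3 dvd b\<close> in presburger)
    moreover have "reflects_to_unit (k - 2 * l) (2 * k + 2 * l - b) (b - l + 2 * k)"
      by (rule all_reflect_to_unitD[OF all])
        (simp add: m2 power2_eq_square algebra_simps, use 2 \<open>\<not> 3 dvd b\<close> in presburger)
    ultimately show ?thesis unfolding m1 by (rule neighbour_second_values[OF r1 r2])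
  next
    case 3
    \<comment> \<open>Case 2 for \<open>(a, -c, -b)\<close>, that is, with \<open>3l - b\<close> in place of \<open>b\<close>.\<close>
    define d where "d = 3 * l - b"
    have m3: "m = (k - 2 * l)\<^sup>2 + (d - 2 * k - 2 * l)\<^sup>2 + (d - l + 2 * k)\<^sup>2"
      unfolding m2 d_def by (simp add: power2_eq_square algebra_simps)
    have m1': "m = (3 * k)\<^sup>2 + d\<^sup>2 + (d - 3 * l)\<^sup>2"
      unfolding m1 d_def by (simp add: power2_eq_square algebra_simps)
    have "3 dvd d + k + l" "\<not> 3 dvd d"
      using 3 \<open>\<not> 3 dvd b\<close> unfolding d_def by presburger+
    \<comment> \<open>The triple (3k, d, d - 3l) is the negative of (-3k, b - 3l, b), so
      \<open>r1\<close> and \<open>r2\<close> exchange roles.\<close>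
    have "reflects_to_unit (3 * k) d (d - 3 * l)"
      using r2 reflects_to_unit_minus[of "3 * k" d "d - 3 * l"]
        reflects_to_unit_swap[of "- 3 * k" b "b - 3 * l"]
      by (simp add: d_def)
    moreover have "reflects_to_unit (- 3 * k) d (d - 3 * l)"
      using r1 reflects_to_unit_minus[of "- 3 * k" d "d - 3 * l"]
        reflects_to_unit_swap[of "3 * k" b "b - 3 * l"]
      by (simp add: d_def)
    moreover have "reflects_to_unit (k - 2 * l) (d - 2 * k - 2 * l) (d - l + 2 * k)"
      by (rule all_reflect_to_unitD[OF all m3]) (use \<open>3 dvd d + k + l\<close> \<open>\<not> 3 dvd d\<close> in presburger)
    moreover have "reflects_to_unit (k - 2 * l) (2 * k + 2 * l - d) (d - l + 2 * k)"
      by (rule all_reflect_to_unitD[OF all])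
        (simp add: m3 power2_eq_square algebra_simps, use \<open>3 dvd d + k + l\<close> \<open>\<not> 3 dvd d\<close> in presburger)
    ultimately show ?thesis unfolding m1' by (rule neighbour_second_values)
  qed
qed

lemma all_reflect_to_unit_values:
  assumes all: "all_reflect_to_unit m" and m: "m = a\<^sup>2 + b\<^sup>2 + c\<^sup>2"
    and "\<not> (3 dvd a \<and> 3 dvd b \<and> 3 dvd c)"
  shows "m \<in> {1, 3, 19} \<union> {2, 14, 155}"
proof -
  consider (none) "\<not> 3 dvd a" "\<not> 3 dvd b" "\<not> 3 dvd c"
    | (two) "\<not> 3 dvd - a + b + c" "\<not> 3 dvd a + - b + c" "\<not> 3 dvd a + b + - c"
    | (a) "3 dvd a" "\<not> 3 dvd b" "\<not> 3 dvd c"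
    | (b) "3 dvd b" "\<not> 3 dvd a" "\<not> 3 dvd c"
    | (c) "3 dvd c" "\<not> 3 dvd a" "\<not> 3 dvd b"
  proof -
    \<comment> \<open>Each sum is congruent to plus or minus the one entry that 3 does not
      divide.\<close>
    have "\<not> 3 dvd - a + b + c \<and> \<not> 3 dvd a + - b + c \<and> \<not> 3 dvd a + b + - c"
      if "3 dvd a \<and> 3 dvd b \<or> 3 dvd a \<and> 3 dvd c \<or> 3 dvd b \<and> 3 dvd c"
      using that assms(3) by presburger
    then show ?thesis using that by blast
  qed
  then show ?thesis
  proof cases
    case none
    \<comment> \<open>With a, b' and c' congruent modulo 3, flipping any one sign leaves a sum
      congruent to a.\<close>
    obtain b' where b': "b'\<^sup>2 = b\<^sup>2" "3 dvd a - b'" using exists_sign_change[OF none(1,2)] .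
    obtain c' where c': "c'\<^sup>2 = c\<^sup>2" "3 dvd a - c'" using exists_sign_change[OF none(1,3)] .
    have "m = a\<^sup>2 + b'\<^sup>2 + c'\<^sup>2" using m b' c' by simp
    moreover have "\<not> 3 dvd - a + b' + c'" "\<not> 3 dvd a + - b' + c'" "\<not> 3 dvd a + b' + - c'"
      using none(1) b'(2) c'(2) by presburger+
    ultimately show ?thesis using three_sign_classes_case[OF all] by blast
  next
    case two
    then show ?thesis using three_sign_classes_case[OF all m] by blast
  next
    case a
    then show ?thesis using one_3_dvd_case[OF all m] by blast
  next
    case b
    have "m = b\<^sup>2 + a\<^sup>2 + c\<^sup>2" using m by simp
    then show ?thesis using one_3_dvd_case[OF all] b by blast
  next
    case c
    have "m = c\<^sup>2 + a\<^sup>2 + b\<^sup>2" using m by simp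
    then show ?thesis using one_3_dvd_case[OF all] c by blast
  qed
qed

theorem theorem4p2:
  fixes m :: int
  assumes "m > 0"
    and "\<exists>a b c :: int. m = a\<^sup>2 + b\<^sup>2 + c\<^sup>2"
    and "m \<notin> {1, 2, 3, 14}"
  shows "\<exists>x y z :: int. x\<^sup>2 + y\<^sup>2 + z\<^sup>2 = 9 * m
           \<and> \<not> [x * y * z = 0] (mod 3)
           \<and> (x\<^sup>2 - 1) * (y\<^sup>2 - 1) * (z\<^sup>2 - 1) \<noteq> 0"
proof (cases "all_reflect_to_unit m")
  case True
  obtain a b c where "m = a\<^sup>2 + b\<^sup>2 + c\<^sup>2" "\<not> (3 dvd a \<and> 3 dvd b \<and> 3 dvd c)"
    using assms(1,2) exists_rep_not_all_3_dvd by metis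
  then have "m = 19 \<or> m = 155"
    using all_reflect_to_unit_values[OF True] assms(3) by blast
  then show ?thesis
  proof
    assume "m = 19"
    \<comment> \<open>The reflection of (3, 3, 1).\<close>
    then show ?thesis by (intro exI[of _ 5] exI[of _ 5] exI[of _ 11]) (simp add: cong_def)
  next
    assume "m = 155"
    \<comment> \<open>The reflection of (11, 5, 3).\<close>
    then show ?thesis by (intro exI[of _ 5] exI[of _ 23] exI[of _ 29]) (simp add: cong_def)
  qed
next
  case False
  then obtain a b c where m: "m = a\<^sup>2 + b\<^sup>2 + c\<^sup>2"
    and s: "\<not> 3 dvd a + b + c" and unit: "\<not> reflects_to_unit a b c"
    unfolding all_reflect_to_unit_def by blast
  let ?x = "2 * b + 2 * c - a" and ?y = "2 * a + 2 * c - b" and ?z = "2 * a + 2 * b - c"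
  have "?x\<^sup>2 + ?y\<^sup>2 + ?z\<^sup>2 = 9 * m"
    unfolding m by (rule sum_squares_reflection)
  moreover have "\<not> 3 dvd ?x * ?y * ?z"
    using not_3_dvd_reflection[OF s] by (simp add: prime_dvd_mult_iff)
  then have "\<not> [?x * ?y * ?z = 0] (mod 3)"
    by (simp add: cong_0_iff)
  moreover have "(?x\<^sup>2 - 1) * (?y\<^sup>2 - 1) * (?z\<^sup>2 - 1) \<noteq> 0"
    using unit unfolding reflects_to_unit_def
    by (auto simp: power2_eq_1_iff)
  ultimately show ?thesis by blast
qed

end
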